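(* Let $s_1, s_2 \ge 2$ and let $f_{1,1}, \ldots, f_{1,s_1}, f_{2,1}, \ldots, f_{2,s_2} \in \mathbb{Z}(X)$ be product-type expressions such that $\operatorname{Var}(f_{1,1}), \ldots, \operatorname{Var}(f_{1,s_1})$ are mutually disjoint and $\operatorname{Var}(f_{2,1}), \ldots, \operatorname{Var}(f_{2,s_2})$ are mutually disjoint, and suppose $\sum_{i=1}^{s_1} f_{1,i}$ and $\sum_{i=1}^{s_2} f_{2,i}$ are sum-type expressions of positive depth. Then $\sum_{i=1}^{s_1} f_{1,i} = \sum_{i=1}^{s_2} f_{2,i}$ holds if and only if $s_2 = s_1$ and there exists a permutation $\pi$ of $\{1,\dots,s_1\}$ such that $f_{2,\pi(i)} = f_{1,i}$ for every $1 \le i \le s_1$.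
   Context: Let $X = \{x_1, x_2, \ldots\}$ be a countably infinite set of formal variables, $\mathbb{Z}[X]$ the integer polynomial ring and $\mathbb{Z}(X)$ its field of fractions. For $f \in \mathbb{Z}(X)$ with canonical representation $f = \frac{P}{Q}$ ($P,Q$ coprime, $Q \ne 0$), $\operatorname{Var}(f)$ is the set of variables $x_i$ that occur with positive exponent in some monomial with nonzero coefficient of $P$ or of $Q$. Sum-type and product-type expressions of depth $0$ are the elements $x_i$ and $-x_i$, $i \in \mathbb{N}$. For $k \in \mathbb{N}$: a sum-type expression of depth $k$ is an $f \in \mathbb{Z}(X)$ that can be written as $f = \sum_{i=1}^s f_i$ with $s \ge 2$, where the nonzero $f_1,\dots,f_s$ are all product-type expressions of depth at most $k-1$, at least one of depth exactly $k-1$, and $\operatorname{Var}(f_1),\dots,\operatorname{Var}(f_s)$ are mutually disjoint. A product-type expression of depth $k$ is an $f \in \mathbb{Z}(X)$ that can be written as $f = \frac{\prod_{i=1}^s f_i}{\prod_{i=1}^t g_i}$ with $s \ge 1$, $t \ge 0$, $s+t \ge 2$, where the nonzero $f_1,\dots,f_s,g_1,\dots,g_t$ are all sum-type expressions of depth at most $k-1$, at least one of depth exactly $k-1$, and $\operatorname{Var}(f_1),\dots,\operatorname{Var}(f_s),\operatorname{Var}(g_1),\dots,\operatorname{Var}(g_t)$ are mutually disjoint. A sum-type (resp. product-type) expression is one of some depth $k \in \mathbb{N}_0$. *)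

theory Defs
  imports
    "HOL-Library.Poly_Mapping"
    "HOL-Library.Disjoint_Sets"
    "HOL-Computational_Algebra.Fraction_Field"
    "HOL-Combinatorics.Permutations"
begin

text \<open>
  A monomial is its finitely supported exponent function; a polynomial maps
  monomials to their coefficients. The variables are indexed by all of \<^typ>\<open>nat\<close>,
  that is, starting from 0 rather than from 1.
\<close>

type_synonym zpoly = "(nat \<Rightarrow>\<^sub>0 nat) \<Rightarrow>\<^sub>0 int"

type_synonym zratfun = "zpoly fract"

definition var :: "nat \<Rightarrow> zratfun" where
  "var i = Fract (Poly_Mapping.single (Poly_Mapping.single i 1) 1) 1"

definition poly_vars :: "zpoly \<Rightarrow> nat set" where
  "poly_vars P = (\<Union>m\<in>Poly_Mapping.keys P. Poly_Mapping.keys m)"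

text \<open>
  The body is that of the library's \<open>coprime\<close>, which is not available at this type
  because it lives in a class with a division operation.
\<close>

definition poly_coprime :: "zpoly \<Rightarrow> zpoly \<Rightarrow> bool" where
  "poly_coprime P Q \<longleftrightarrow> (\<forall>C. C dvd P \<longrightarrow> C dvd Q \<longrightarrow> C dvd 1)"

text \<open>
  The coprime representation exists and is unique up to a common sign, which does not
  affect the variables that occur; hence the existential quantifier over \<open>P\<close> and \<open>Q\<close>.
\<close>

definition Var :: "zratfun \<Rightarrow> nat set" where
  "Var f = {i. \<exists>P Q. Q \<noteq> 0 \<and> poly_coprime P Q \<and> f = Fract P Q \<and> i \<in> poly_vars P \<union> poly_vars Q}"

inductive sum_expr :: "nat \<Rightarrow> zratfun \<Rightarrow> bool"
  and prod_expr :: "nat \<Rightarrow> zratfun \<Rightarrow> bool"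
where
  sum_var: "sum_expr 0 (var i)"
| sum_neg_var: "sum_expr 0 (- var i)"
| prod_var: "prod_expr 0 (var i)"
| prod_neg_var: "prod_expr 0 (- var i)"
| sum_Suc:
    "\<lbrakk> s \<ge> (2::nat);
       \<forall>i\<in>{1..s}. f i \<noteq> 0 \<and> (\<exists>j\<le>k. prod_expr j (f i));
       \<exists>i\<in>{1..s}. prod_expr k (f i);
       disjoint_family_on (\<lambda>i. Var (f i)) {1..s} \<rbrakk>
     \<Longrightarrow> sum_expr (Suc k) (\<Sum>i=1..s. f i)"
| prod_Suc:
    "\<lbrakk> s \<ge> (1::nat); s + t \<ge> 2;
       \<forall>i\<in>{1..s}. f i \<noteq> 0 \<and> (\<exists>j\<le>k. sum_expr j (f i));
       \<forall>i\<in>{1..t}. g i \<noteq> 0 \<and> (\<exists>j\<le>k. sum_expr j (g i));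
       (\<exists>i\<in>{1..s}. sum_expr k (f i)) \<or> (\<exists>i\<in>{1..t}. sum_expr k (g i));
       disjoint_family_on (\<lambda>i. Var (f i)) {1..s};
       disjoint_family_on (\<lambda>i. Var (g i)) {1..t};
       \<forall>i\<in>{1..s}. \<forall>j\<in>{1..t}. Var (f i) \<inter> Var (g j) = {} \<rbrakk>
     \<Longrightarrow> prod_expr (Suc k) ((\<Prod>i=1..s. f i) / (\<Prod>i=1..t. g i))"

definition product_type :: "zratfun \<Rightarrow> bool" where
  "product_type f \<longleftrightarrow> (\<exists>k. prod_expr k f)"

end

theory Submission
  imports Defs
begin

text \<open>
  Substituting \<open>2 * x\<close> for a variable \<open>x\<close> is an endomorphism of the field of rational functions
  that fixes every function in which \<open>x\<close> does not occur, so it can play the role of a partial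
  derivative. Join two variables of \<open>F\<close> by an edge if the mixed difference of \<open>F\<close> in them does not
  vanish. A mixed difference of a sum with disjoint variables vanishes for variables of distinct
  summands, whereas that of a product \<open>p * q\<close> with disjoint variables factors, so that every variable
  of \<open>p\<close> is joined with every variable of \<open>q\<close>. Hence the variable sets of product-type summands are the
  connected components of this graph, and the sum determines each summand up to a constant.
  The constant vanishes: a function \<open>f = p * q\<close> satisfies the multiplicative relation
  \<open>f(x,y) * f(2x,2y) = f(2x,y) * f(x,2y)\<close> for \<open>x\<close> in \<open>p\<close> and \<open>y\<close> in \<open>q\<close>, which \<open>f + c\<close> with \<open>c \<noteq> 0\<close>
  violates.
\<close>

section \<open>Leading monomials and coprime representations\<close>

definition lead_mon :: "('a::linorder \<Rightarrow>\<^sub>0 'b::zero) \<Rightarrow> 'a" where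
  "lead_mon P = Max (Poly_Mapping.keys P)"

lemma lead_mon_in_keys: "P \<noteq> 0 \<Longrightarrow> lead_mon P \<in> Poly_Mapping.keys P"
  unfolding lead_mon_def by (rule Max_in) auto

lemma lead_mon_ge: "m \<in> Poly_Mapping.keys P \<Longrightarrow> m \<le> lead_mon P"
  unfolding lead_mon_def by (rule Max_ge) auto

text \<open>Addition is strictly monotone, so no other pair of keys has the sum
  \<open>lead_mon P + lead_mon Q\<close> and a single term of the convolution survives. If a factor
  is zero, both sides vanish.\<close>

lemma lookup_times_lead:
  fixes P Q :: "'a::{ordered_cancel_comm_monoid_add, linorder} \<Rightarrow>\<^sub>0 'b::semiring_0"
  shows "Poly_Mapping.lookup (P * Q) (lead_mon P + lead_mon Q)
    = Poly_Mapping.lookup P (lead_mon P) * Poly_Mapping.lookup Q (lead_mon Q)"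
proof -
  let ?a = "lead_mon P" and ?b = "lead_mon Q"
  have *: "Poly_Mapping.lookup P l * (\<Sum>q. Poly_Mapping.lookup Q q when ?a + ?b = l + q)
      = (Poly_Mapping.lookup P l * Poly_Mapping.lookup Q ?b when l = ?a)" for l
  proof (cases "l \<in> Poly_Mapping.keys P")
    case False
    then show ?thesis by (simp add: in_keys_iff)
  next
    case l: True
    have "(Poly_Mapping.lookup Q q when ?a + ?b = l + q)
        = ((Poly_Mapping.lookup Q q when l = ?a) when q = ?b)" for q
    proof (cases "q \<in> Poly_Mapping.keys Q")
      case False
      then show ?thesis by (simp add: in_keys_iff)
    next
      case q: True
      have "l = ?a \<and> q = ?b" if "?a + ?b = l + q"
      proof -
        have "l = ?a"
          using that add_less_le_mono[of l ?a q ?b] lead_mon_ge[OF l] lead_mon_ge[OF q]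
          by (metis order.not_eq_order_implies_strict order.irrefl)
        then show ?thesis using that by simp
      qed
      then show ?thesis by (auto simp: when_def)
    qed
    then show ?thesis by (simp add: when_def)
  qed
  show ?thesis by (simp add: lookup_mult *)
qed

lemma lead_mon_times:
  fixes P Q :: "'a::{ordered_cancel_comm_monoid_add, linorder} \<Rightarrow>\<^sub>0 'b::semiring_no_zero_divisors"
  assumes "P \<noteq> 0" "Q \<noteq> 0"
  shows "lead_mon (P * Q) = lead_mon P + lead_mon Q"
  unfolding lead_mon_def[of "P * Q"]
proof (rule Max_eqI)
  show "finite (Poly_Mapping.keys (P * Q))" by simp
next
  fix m assume "m \<in> Poly_Mapping.keys (P * Q)"
  then show "m \<le> lead_mon P + lead_mon Q"
    using keys_mult[of P Q] by (auto intro!: add_mono lead_mon_ge)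
next
  show "lead_mon P + lead_mon Q \<in> Poly_Mapping.keys (P * Q)"
    using assms lead_mon_in_keys[of P] lead_mon_in_keys[of Q]
    by (simp add: in_keys_iff lookup_times_lead)
qed

definition mon_degree :: "('v \<Rightarrow>\<^sub>0 nat) \<Rightarrow> nat" where
  "mon_degree m = (\<Sum>i. Poly_Mapping.lookup m i)"

lemma mon_degree_plus: "mon_degree (m + n) = mon_degree m + mon_degree n"
  unfolding mon_degree_def lookup_add by (rule Sum_any.distrib) auto

lemma mon_degree_eq_0_iff: "mon_degree m = 0 \<longleftrightarrow> m = 0"
  by (auto simp: mon_degree_def Sum_any.expand_set intro!: poly_mapping_eqI)

text \<open>Monomials are compared at the first variable where their exponents differ, and no
  exponent lies below \<open>0\<close>.\<close>

lemma monomial_nonneg: "(0 :: nat \<Rightarrow>\<^sub>0 nat) \<le> m"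
proof -
  have "\<not> m < 0"
    by (auto simp: less_poly_mapping.rep_eq less_fun_def)
  then show ?thesis by simp
qed

text \<open>
  The lexicographic order of the monomials in infinitely many variables is not well-founded,
  whence the total degree of the leading monomial.
\<close>

definition poly_size :: "zpoly \<Rightarrow> nat" where
  "poly_size P = mon_degree (lead_mon P) + nat \<bar>Poly_Mapping.lookup P (lead_mon P)\<bar>"

text \<open>Leading degrees add and leading coefficients multiply. A non-unit \<open>C\<close>
  either has positive leading degree or is a constant of absolute value at least 2.\<close>

lemma poly_size_times_less:
  assumes "P \<noteq> 0" "C \<noteq> 0" "\<not> C dvd 1"
  shows "poly_size P < poly_size (C * P)"
proof -
  let ?c = "Poly_Mapping.lookup C (lead_mon C)" and ?p = "Poly_Mapping.lookup P (lead_mon P)"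
  have nz: "?c \<noteq> 0" "?p \<noteq> 0"
    using lead_mon_in_keys[OF assms(1)] lead_mon_in_keys[OF assms(2)] by (simp_all add: in_keys_iff)
  have eq: "poly_size (C * P)
      = mon_degree (lead_mon C) + mon_degree (lead_mon P) + nat \<bar>?c\<bar> * nat \<bar>?p\<bar>"
    using assms by (simp add: poly_size_def lead_mon_times lookup_times_lead mon_degree_plus
        abs_mult nat_mult_distrib)
  show ?thesis
  proof (cases "mon_degree (lead_mon C) = 0")
    case False
    moreover have "nat \<bar>?p\<bar> \<le> nat \<bar>?c\<bar> * nat \<bar>?p\<bar>" using nz by simp
    ultimately show ?thesis unfolding eq poly_size_def[of P] by linarith
  next
    case True
    then have lm: "lead_mon C = 0" by (simp add: mon_degree_eq_0_iff)
    \<comment> \<open>\<open>0\<close> is the least monomial, so if it is the leading one, it is the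
      only key.\<close>
    have C: "C = Poly_Mapping.single 0 ?c"
    proof (rule poly_mapping_eqI)
      fix m
      show "Poly_Mapping.lookup C m = Poly_Mapping.lookup (Poly_Mapping.single 0 ?c) m"
        using lead_mon_ge[of m C] monomial_nonneg[of m]
        by (cases "m = 0") (auto simp: lm lookup_single when_def in_keys_iff)
    qed
    have "nat \<bar>?c\<bar> \<noteq> 1"
    proof
      assume "nat \<bar>?c\<bar> = 1"
      then have "?c = 1 \<or> ?c = - 1" by linarith
      then have "?c * ?c = 1" by auto
      then have "C * C = 1" by (subst (1 2) C) (simp add: mult_single)
      with assms(3) show False by (metis dvd_triv_left)
    qed
    with nz have "1 < nat \<bar>?c\<bar>" by linarith
    with nz show ?thesis using True by (simp add: eq poly_size_def[of P])
  qed
qed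

text \<open>Cancelling a common non-unit strictly decreases the \<open>poly_size\<close> of the
  denominator. Existence matters because \<open>Var f\<close> would be empty if \<open>f\<close> had
  no coprime representation.\<close>

lemma coprime_representation_exists:
  assumes "Q \<noteq> 0"
  shows "\<exists>P' Q'. Q' \<noteq> 0 \<and> poly_coprime P' Q' \<and> Fract P Q = Fract P' Q'"
  using assms
proof (induction "poly_size Q" arbitrary: P Q rule: less_induct)
  case less
  show ?case
  proof (cases "poly_coprime P Q")
    case True
    with less.prems show ?thesis by blast
  next
    case False
    then obtain C where C: "C dvd P" "C dvd Q" "\<not> C dvd 1"
      unfolding poly_coprime_def by blast
    then obtain P' Q' where PQ: "P = C * P'" "Q = C * Q'" by (auto elim!: dvdE)
    have nz: "C \<noteq> 0" "Q' \<noteq> 0" using PQ less.prems by auto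
    have "Fract P Q = Fract P' Q'" using nz by (simp add: PQ eq_fract mult_ac)
    moreover have "poly_size Q' < poly_size Q"
      using nz C(3) by (simp add: PQ poly_size_times_less)
    ultimately show ?thesis using less.hyps[of Q' P'] nz by auto
  qed
qed

section \<open>Dilating a single variable\<close>

text \<open>The weights \<open>2 ^ e\<close> are nonzero, so the substitution is injective and
  extends to fractions. They equal 1 only for \<open>e = 0\<close>, so every occurrence of the
  variable is detected.\<close>

definition dilate_poly :: "nat \<Rightarrow> zpoly \<Rightarrow> zpoly" where
  "dilate_poly i P = Poly_Mapping.mapp (\<lambda>m c. 2 ^ Poly_Mapping.lookup m i * c) P"

lemma lookup_dilate_poly:
  "Poly_Mapping.lookup (dilate_poly i P) m = 2 ^ Poly_Mapping.lookup m i * Poly_Mapping.lookup P m"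
  by (auto simp: dilate_poly_def lookup_mapp when_def in_keys_iff)

lemma dilate_poly_0 [simp]: "dilate_poly i 0 = 0"
  by (rule poly_mapping_eqI) (simp add: lookup_dilate_poly)

lemma dilate_poly_eq_0_iff [simp]: "dilate_poly i P = 0 \<longleftrightarrow> P = 0"
  by (auto simp: poly_mapping_eq_iff lookup_dilate_poly fun_eq_iff)

lemma dilate_poly_1 [simp]: "dilate_poly i 1 = 1"
  by (rule poly_mapping_eqI) (auto simp: lookup_dilate_poly lookup_one when_def)

lemma dilate_poly_uminus [simp]: "dilate_poly i (- P) = - dilate_poly i P"
  by (rule poly_mapping_eqI) (simp add: lookup_dilate_poly)

lemma dilate_poly_plus [simp]: "dilate_poly i (P + Q) = dilate_poly i P + dilate_poly i Q"
  by (rule poly_mapping_eqI) (simp add: lookup_dilate_poly lookup_add distrib_left)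

text \<open>The weight of a monomial is multiplicative in the monomial, so it passes through the
  convolution.\<close>

lemma dilate_poly_times [simp]: "dilate_poly i (P * Q) = dilate_poly i P * dilate_poly i Q"
proof (rule poly_mapping_eqI)
  fix m
  let ?P = "Poly_Mapping.lookup P" and ?Q = "Poly_Mapping.lookup Q"
  let ?e = "\<lambda>m. 2 ^ Poly_Mapping.lookup m i :: int"
  have fin: "finite {q. (?Q q when m = l + q) \<noteq> 0}" for l
    by (rule finite_subset[OF _ finite_lookup[of Q]]) (auto simp: when_def)
  have inner: "?e l * ?P l * (\<Sum>q. ?e q * ?Q q when m = l + q)
      = ?e m * (?P l * (\<Sum>q. ?Q q when m = l + q))" for l
  proof -
    have "?e m * (\<Sum>q. ?Q q when m = l + q) = (\<Sum>q. ?e m * (?Q q when m = l + q))"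
      by (rule Sum_any_right_distrib) (rule fin)
    also have "\<dots> = (\<Sum>q. ?e l * (?e q * ?Q q when m = l + q))"
      by (rule Sum_any.cong) (auto simp: when_def lookup_add power_add)
    also have "\<dots> = ?e l * (\<Sum>q. ?e q * ?Q q when m = l + q)"
      by (rule Sum_any_right_distrib[symmetric]) (rule finite_subset[OF _ fin[of l]], auto simp: when_def)
    finally show ?thesis by (simp add: mult_ac)
  qed
  have "finite {l. ?P l * (\<Sum>q. ?Q q when m = l + q) \<noteq> 0}"
    by (rule finite_subset[OF _ finite_lookup[of P]]) auto
  then show "Poly_Mapping.lookup (dilate_poly i (P * Q)) m
      = Poly_Mapping.lookup (dilate_poly i P * dilate_poly i Q) m"
    by (simp add: lookup_mult lookup_dilate_poly inner Sum_any_right_distrib)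
qed

lemma dilate_poly_commute: "dilate_poly i (dilate_poly j P) = dilate_poly j (dilate_poly i P)"
  by (rule poly_mapping_eqI) (simp add: lookup_dilate_poly)

lemma dilate_poly_id:
  assumes "i \<notin> poly_vars P"
  shows "dilate_poly i P = P"
proof (rule poly_mapping_eqI)
  fix m
  show "Poly_Mapping.lookup (dilate_poly i P) m = Poly_Mapping.lookup P m"
    using assms by (cases "m \<in> Poly_Mapping.keys P")
      (auto simp: lookup_dilate_poly poly_vars_def in_keys_iff)
qed

lift_definition dilate :: "nat \<Rightarrow> zratfun \<Rightarrow> zratfun"
  is "\<lambda>i (P, Q). (dilate_poly i P, dilate_poly i Q)"
  by (auto simp: fractrel_def simp flip: dilate_poly_times)

lemma dilate_Fract [simp]: "dilate i (Fract P Q) = Fract (dilate_poly i P) (dilate_poly i Q)"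
  by transfer auto

lemma dilate_0 [simp]: "dilate i 0 = 0"
  by (simp add: Zero_fract_def)

lemma dilate_1 [simp]: "dilate i 1 = 1"
  by (simp add: One_fract_def)

lemma two_eq_Fract: "(2 :: zratfun) = Fract 2 1"
  using of_nat_fract[of 2] by simp

lemma dilate_numeral_2 [simp]: "dilate i 2 = 2"
  unfolding two_eq_Fract dilate_Fract
  using dilate_poly_plus[of i 1 1] by simp

lemma dilate_plus [simp]: "dilate i (f + g) = dilate i f + dilate i g"
  by (cases f, cases g) simp

lemma dilate_uminus [simp]: "dilate i (- f) = - dilate i f"
  by (cases f) simp

lemma dilate_diff [simp]: "dilate i (f - g) = dilate i f - dilate i g"
  using dilate_plus[of i f "- g"] by simp

lemma dilate_times [simp]: "dilate i (f * g) = dilate i f * dilate i g"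
  by (cases f, cases g) simp

lemma dilate_inverse [simp]: "dilate i (inverse f) = inverse (dilate i f)"
  by (cases f) simp

lemma dilate_sum [simp]: "dilate i (sum f A) = (\<Sum>a\<in>A. dilate i (f a))"
  by (induction A rule: infinite_finite_induct) auto

lemma dilate_commute: "dilate i (dilate j f) = dilate j (dilate i f)"
  by (cases f) (simp add: dilate_poly_commute)

lemma dilate_var: "dilate i (var j) = (if i = j then 2 * var j else var j)"
proof -
  let ?x = "Poly_Mapping.single (Poly_Mapping.single j 1) 1 :: zpoly"
  have "dilate_poly i ?x = (if i = j then 2 else 1) * ?x"
  proof (rule poly_mapping_eqI)
    fix m
    have "(if i = j then 2 else 1) * ?x
        = Poly_Mapping.single (Poly_Mapping.single j 1) (if i = j then 2 else 1)"
      using mult_single[of 0 2 "Poly_Mapping.single j 1 :: nat \<Rightarrow>\<^sub>0 nat" "1 :: int"] by simp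
    then show "Poly_Mapping.lookup (dilate_poly i ?x) m
        = Poly_Mapping.lookup ((if i = j then 2 else 1) * ?x) m"
      by (auto simp only: lookup_dilate_poly lookup_single when_def)
        (auto simp: lookup_single when_def)
  qed
  then show ?thesis
    unfolding var_def two_eq_Fract dilate_Fract mult_fract dilate_poly_1 mult_1_left by simp
qed

lemma var_nonzero: "var i \<noteq> 0"
  unfolding var_def Zero_fract_def by (simp add: eq_fract flip: keys_eq_empty)

section \<open>Dependence on a variable\<close>

definition dependence :: "zratfun \<Rightarrow> nat set" where
  "dependence f = {i. dilate i f \<noteq> f}"

lemma notin_dependence: "i \<notin> dependence f \<longleftrightarrow> dilate i f = f"
  by (simp add: dependence_def)

text \<open>A variable absent from a coprime numerator and denominator is not seen by dilation.
  Through this inclusion, disjointness of \<open>Var\<close> passes to \<open>dependence\<close>,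
  which needs no normal form.\<close>

lemma dependence_subset_Var: "dependence f \<subseteq> Var f"
proof
  fix i assume i: "i \<in> dependence f"
  obtain P0 Q0 where "f = Fract P0 Q0" "Q0 \<noteq> 0" by (cases f)
  then obtain P Q where PQ: "Q \<noteq> 0" "poly_coprime P Q" "f = Fract P Q"
    using coprime_representation_exists by metis
  have "i \<in> poly_vars P \<union> poly_vars Q"
  proof (rule ccontr)
    assume "i \<notin> poly_vars P \<union> poly_vars Q"
    then have "dilate i f = f" by (simp add: PQ(3) dilate_poly_id)
    with i show False by (simp add: dependence_def)
  qed
  with PQ show "i \<in> Var f" unfolding Var_def by blast
qed

lemma dependence_uminus [simp]: "dependence (- f) = dependence f"
  by (auto simp: dependence_def)

lemma dependence_inverse [simp]: "dependence (inverse f) = dependence f"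
  by (auto simp: dependence_def)

lemma dependence_1 [simp]: "dependence 1 = {}"
  by (simp add: dependence_def)

lemma dependence_0 [simp]: "dependence 0 = {}"
  by (simp add: dependence_def)

lemma dependence_var [simp]: "dependence (var i) = {i}"
proof -
  have "2 * var i \<noteq> var i"
    using var_nonzero[of i] unfolding mult_2 add_cancel_left_right .
  then show ?thesis unfolding dependence_def dilate_var by auto
qed

text \<open>Each dilation moves at most one of the two summands, so changes cannot cancel.\<close>

lemma dependence_plus:
  assumes "dependence f \<inter> dependence g = {}"
  shows "dependence (f + g) = dependence f \<union> dependence g"
proof (rule set_eqI)
  fix i
  have "dilate i f = f \<or> dilate i g = g"
    using assms by (auto simp: dependence_def)
  then show "i \<in> dependence (f + g) \<longleftrightarrow> i \<in> dependence f \<union> dependence g"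
    using assms by (auto simp: dependence_def)
qed

lemma dependence_times:
  assumes "dependence f \<inter> dependence g = {}" "f \<noteq> 0" "g \<noteq> 0"
  shows "dependence (f * g) = dependence f \<union> dependence g"
proof (rule set_eqI)
  fix i
  have "dilate i f = f \<or> dilate i g = g"
    using assms by (auto simp: dependence_def)
  then show "i \<in> dependence (f * g) \<longleftrightarrow> i \<in> dependence f \<union> dependence g"
    using assms by (auto simp: dependence_def)
qed

lemma dependence_sum:
  assumes "finite A" "disjoint_family_on (\<lambda>a. dependence (f a)) A"
  shows "dependence (sum f A) = (\<Union>a\<in>A. dependence (f a))"
  using assms
proof (induction A rule: finite_induct)
  case (insert a A)
  then have "dependence (sum f A) = (\<Union>a\<in>A. dependence (f a))"
    by (metis disjoint_family_on_mono subset_insertI)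
  moreover have "dependence (f a) \<inter> (\<Union>a\<in>A. dependence (f a)) = {}"
    using insert by (simp add: disjoint_family_on_insert)
  ultimately show ?case using insert by (simp add: dependence_plus)
qed simp

lemma dependence_prod:
  assumes "finite A" "\<forall>a\<in>A. f a \<noteq> 0" "disjoint_family_on (\<lambda>a. dependence (f a)) A"
  shows "dependence (prod f A) = (\<Union>a\<in>A. dependence (f a))"
  using assms
proof (induction A rule: finite_induct)
  case (insert a A)
  then have "dependence (prod f A) = (\<Union>a\<in>A. dependence (f a))"
    by (metis disjoint_family_on_mono subset_insertI insertCI)
  moreover have "dependence (f a) \<inter> (\<Union>a\<in>A. dependence (f a)) = {}"
    using insert by (simp add: disjoint_family_on_insert)
  ultimately show ?case using insert by (simp add: dependence_times)
qed simp

lemma disjoint_family_dependence: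
  "disjoint_family_on (\<lambda>i. Var (f i)) A \<Longrightarrow> disjoint_family_on (\<lambda>i. dependence (f i)) A"
  using dependence_subset_Var unfolding disjoint_family_on_def by fastforce

section \<open>Mixed differences of sum- and product-type expressions\<close>

text \<open>The expansion of the composed difference operators \<open>dilate a - id\<close> and
  \<open>dilate b - id\<close>.\<close>

definition mixed_diff :: "nat \<Rightarrow> nat \<Rightarrow> zratfun \<Rightarrow> zratfun" where
  "mixed_diff a b f = dilate a (dilate b f) - dilate a f - dilate b f + f"

lemma mixed_diff_sum: "mixed_diff a b (sum f A) = (\<Sum>i\<in>A. mixed_diff a b (f i))"
  by (simp add: mixed_diff_def sum.distrib sum_subtractf)

lemma mixed_diff_eq_0:
  assumes "a \<notin> dependence f \<or> b \<notin> dependence f"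
  shows "mixed_diff a b f = 0"
  using assms dilate_commute[of a b f] by (auto simp: mixed_diff_def dependence_def)

lemma mixed_diff_times:
  assumes "a \<notin> dependence q" "b \<notin> dependence p"
  shows "mixed_diff a b (p * q) = (dilate a p - p) * (dilate b q - q)"
proof -
  have "dilate a (dilate b q) = dilate b q"
    using assms(1) by (simp add: dilate_commute[of a b q] notin_dependence)
  then show ?thesis
    using assms by (simp add: mixed_diff_def notin_dependence algebra_simps)
qed

section \<open>Factorisations with disjoint dependence\<close>

definition splits :: "zratfun \<Rightarrow> zratfun \<Rightarrow> bool" where
  "splits p q \<longleftrightarrow> p \<noteq> 0 \<and> q \<noteq> 0 \<and> dependence p \<noteq> {} \<and> dependence q \<noteq> {}
    \<and> dependence p \<inter> dependence q = {}"

lemma dependence_splits: "splits p q \<Longrightarrow> dependence (p * q) = dependence p \<union> dependence q"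
  unfolding splits_def by (intro dependence_times) auto

lemma mixed_diff_splits:
  assumes "splits p q" "a \<in> dependence p" "b \<in> dependence q"
  shows "mixed_diff a b (p * q) \<noteq> 0"
proof -
  have "a \<notin> dependence q" "b \<notin> dependence p" using assms by (auto simp: splits_def)
  then show ?thesis using assms by (simp add: mixed_diff_times dependence_def)
qed

text \<open>The first numerator factor is separated from the rest. The factors are only assumed to
  be nonconstant, so that the lemma also applies inside the induction that proves this
  property.\<close>

lemma splits_quotient:
  fixes f g :: "nat \<Rightarrow> zratfun"
  assumes st: "s \<ge> 1" "s + t \<ge> 2"
    and f: "\<forall>i\<in>{1..s}. f i \<noteq> 0 \<and> dependence (f i) \<noteq> {}"
    and g: "\<forall>i\<in>{1..t}. g i \<noteq> 0 \<and> dependence (g i) \<noteq> {}"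
    and ff: "disjoint_family_on (\<lambda>i. Var (f i)) {1..s}"
    and gg: "disjoint_family_on (\<lambda>i. Var (g i)) {1..t}"
    and fg: "\<forall>i\<in>{1..s}. \<forall>j\<in>{1..t}. Var (f i) \<inter> Var (g j) = {}"
  shows "splits (f 1) ((\<Prod>i=2..s. f i) / (\<Prod>i=1..t. g i))"
proof -
  let ?F = "\<Prod>i=2..s. f i" and ?G = "\<Prod>i=1..t. g i"
  note ff = disjoint_family_dependence[OF ff] and gg = disjoint_family_dependence[OF gg]
  have fg: "dependence (f i) \<inter> dependence (g j) = {}" if "i \<in> {1..s}" "j \<in> {1..t}" for i j
    using fg dependence_subset_Var[of "f i"] dependence_subset_Var[of "g j"] that by fast
  have nz: "?F \<noteq> 0" "?G \<noteq> 0" using f g by auto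
  have F: "dependence ?F = (\<Union>i\<in>{2..s}. dependence (f i))"
    using f disjoint_family_on_mono[OF _ ff, of "{2..s}"] by (intro dependence_prod) auto
  have G: "dependence ?G = (\<Union>i\<in>{1..t}. dependence (g i))"
    using g gg by (intro dependence_prod) auto
  have "dependence ?F \<inter> dependence ?G = {}"
  proof -
    have "dependence (f i) \<inter> dependence (g j) = {}" if "i \<in> {2..s}" "j \<in> {1..t}" for i j
      using that by (intro fg) auto
    then show ?thesis unfolding F G by blast
  qed
  then have FG: "dependence (?F / ?G) = dependence ?F \<union> dependence ?G"
    using nz by (simp add: divide_inverse dependence_times)
  \<comment> \<open>As \<open>s + t \<ge> 2\<close>, the rest still contains the factor
    \<open>f 2\<close> or \<open>g 1\<close>.\<close>
  have "2 \<in> {2..s} \<or> 1 \<in> {1..t}" using st by auto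
  then have "dependence (?F / ?G) \<noteq> {}"
    unfolding FG F G using f g by fastforce
  moreover have "dependence (f 1) \<inter> dependence (?F / ?G) = {}"
  proof -
    have "dependence (f 1) \<inter> dependence (f i) = {}" if "i \<in> {2..s}" for i
      using that ff by (auto simp: disjoint_family_on_def)
    moreover have "dependence (f 1) \<inter> dependence (g j) = {}" if "j \<in> {1..t}" for j
      using that st(1) by (intro fg) auto
    ultimately show ?thesis unfolding FG F G by blast
  qed
  ultimately show ?thesis using f st nz by (auto simp: splits_def)
qed

lemma product_quotient_split:
  fixes f g :: "nat \<Rightarrow> zratfun"
  assumes "s \<ge> 1"
  shows "(\<Prod>i=1..s. f i) / (\<Prod>i=1..t. g i) = f 1 * ((\<Prod>i=2..s. f i) / (\<Prod>i=1..t. g i))"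
  using prod.atLeast_Suc_atMost[OF assms, of f] by (simp add: numeral_2_eq_2)

lemma sum_expr_dependence: "sum_expr k f \<Longrightarrow> dependence f \<noteq> {}"
  and prod_expr_dependence: "prod_expr k f \<Longrightarrow> dependence f \<noteq> {}"
proof (induction rule: sum_expr_prod_expr.inducts)
  case (sum_Suc s f k)
  have "dependence (\<Sum>i=1..s. f i) = (\<Union>i\<in>{1..s}. dependence (f i))"
    using sum_Suc disjoint_family_dependence by (intro dependence_sum) auto
  moreover have "1 \<in> {1..s}" using sum_Suc by auto
  ultimately show ?case using sum_Suc by blast
next
  case (prod_Suc s t f k g)
  have "splits (f 1) ((\<Prod>i=2..s. f i) / (\<Prod>i=1..t. g i))"
    using prod_Suc by (intro splits_quotient) auto
  from this dependence_splits[OF this] show ?case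
    unfolding product_quotient_split[OF prod_Suc.hyps(1)] splits_def by simp
qed simp_all

text \<open>Depth \<open>0\<close> gives the first case, positive depth the second. Together with
  \<open>product_type_dependence\<close> this replaces the inductive definition from here
  on.\<close>

lemma product_type_cases:
  assumes "product_type f"
  obtains (var) i where "f = var i \<or> f = - var i"
    | (splits) p q where "splits p q" "f = p * q"
proof -
  obtain k where "prod_expr k f" using assms by (auto simp: product_type_def)
  then show thesis
  proof cases
    case (prod_Suc s t F k G)
    have "splits (F 1) ((\<Prod>i=2..s. F i) / (\<Prod>i=1..t. G i))"
      using prod_Suc sum_expr_dependence by (intro splits_quotient) blast+
    then show thesis
      using splits product_quotient_split[OF prod_Suc(3)] prod_Suc(2) by metis
  qed (use var in blast)+
qed

lemma product_type_dependence: "product_type f \<Longrightarrow> dependence f \<noteq> {}"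
  using prod_expr_dependence by (auto simp: product_type_def)

section \<open>Uniqueness of the summands\<close>

text \<open>Edges join all of \<open>dependence p\<close> to all of \<open>dependence q\<close>, so
  the graph on \<open>dependence f\<close> is connected, and no edge leaves a summand
  \<open>g j\<close>.\<close>

lemma dependence_within_summand:
  assumes f: "product_type f"
    and A: "finite A" "disjoint_family_on (\<lambda>j. dependence (g j)) A"
    and cover: "dependence f \<subseteq> (\<Union>j\<in>A. dependence (g j))"
    and mixed: "\<And>a b. a \<in> dependence f \<Longrightarrow> b \<in> dependence f \<Longrightarrow>
      mixed_diff a b f = mixed_diff a b (sum g A)"
  shows "\<exists>j\<in>A. dependence f \<subseteq> dependence (g j)"
  using f
proof (cases rule: product_type_cases)
  case (var i)
  then have "dependence f = {i}" by auto
  with cover show ?thesis by auto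
next
  case (splits p q)
  have linked: "b \<in> dependence (g j)"
    if "a \<in> dependence p \<and> b \<in> dependence q \<or> a \<in> dependence q \<and> b \<in> dependence p"
      "j \<in> A" "a \<in> dependence (g j)" for a b j
  proof (rule ccontr)
    assume b: "b \<notin> dependence (g j)"
    have "mixed_diff a b f \<noteq> 0"
    proof -
      have sym: "mixed_diff a b f = mixed_diff b a f"
        using dilate_commute[of a b f] by (simp add: mixed_diff_def)
      show ?thesis
        using that(1) mixed_diff_splits[OF splits(1)] splits(2) sym by auto
    qed
    \<comment> \<open>The summand \<open>g j\<close> misses \<open>b\<close>, and by disjointness
      every other summand misses \<open>a\<close>.\<close>
    moreover have "mixed_diff a b (g l) = 0" if "l \<in> A" for l
    proof (rule mixed_diff_eq_0, rule ccontr)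
      assume "\<not> (a \<notin> dependence (g l) \<or> b \<notin> dependence (g l))"
      moreover from this have "l \<noteq> j" using b by auto
      ultimately show False
        using A(2) that \<open>j \<in> A\<close> \<open>a \<in> dependence (g j)\<close> by (auto simp: disjoint_family_on_def)
    qed
    ultimately show False
      using mixed[of a b] that(1) by (auto simp: splits(2) dependence_splits[OF splits(1)] mixed_diff_sum)
  qed
  obtain a where a: "a \<in> dependence p" using splits by (auto simp: splits_def)
  obtain b where b: "b \<in> dependence q" using splits by (auto simp: splits_def)
  obtain j where j: "j \<in> A" "a \<in> dependence (g j)"
    using cover a by (auto simp: splits(2) dependence_splits[OF splits(1)])
  \<comment> \<open>One edge leads from \<open>a\<close> to each variable of \<open>q\<close>, then
    one from \<open>b\<close> back to each variable of \<open>p\<close>.\<close>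
  have "dependence q \<subseteq> dependence (g j)" using linked a j by blast
  moreover from this have "dependence p \<subseteq> dependence (g j)" using linked b j by blast
  ultimately show ?thesis using j by (auto simp: splits(2) dependence_splits[OF splits(1)])
qed

section \<open>Excluding an additive constant\<close>

text \<open>Take any \<open>a\<close> in \<open>A\<close> and \<open>b\<close> in \<open>B\<close>.
  If both lie in \<open>A'\<close>, an element of \<open>B'\<close> can replace one of them; if both
  lie in \<open>B'\<close>, an element of \<open>A'\<close> can.\<close>

lemma commonly_separated_pair:
  assumes "A \<union> B = A' \<union> B'" "A \<noteq> {}" "B \<noteq> {}" "A' \<noteq> {}" "B' \<noteq> {}"
  obtains a b where "a \<in> A" "b \<in> B" "a \<in> A' \<and> b \<in> B' \<or> b \<in> A' \<and> a \<in> B'"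
proof -
  obtain a b where ab: "a \<in> A" "b \<in> B" using assms by auto
  obtain a' b' where ab': "a' \<in> A'" "b' \<in> B'" using assms by auto
  have "a \<in> A' \<or> a \<in> B'" "b \<in> A' \<or> b \<in> B'" "a' \<in> A \<or> a' \<in> B" "b' \<in> A \<or> b' \<in> B"
    using assms(1) ab ab' by auto
  then show thesis using that ab ab' by metis
qed

text \<open>For variables separated by both factorisations, \<open>p * q\<close> and
  \<open>p * q + c\<close> both satisfy the multiplicative relation. Subtracting the two relations
  leaves \<open>c * mixed_diff a b (p * q) = 0\<close>.\<close>

lemma splits_constant_diff_eq_0:
  assumes "splits p q" "splits p' q'" "dependence (p' * q') = dependence (p * q)"
    and eq: "p' * q' = p * q + c" and c: "dependence c = {}"
  shows "c = 0"
proof -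
  have "dependence p \<union> dependence q = dependence p' \<union> dependence q'"
    using assms(3) dependence_splits[OF assms(1)] dependence_splits[OF assms(2)] by simp
  then obtain a b where ab: "a \<in> dependence p" "b \<in> dependence q"
    and ab': "a \<in> dependence p' \<and> b \<in> dependence q' \<or> b \<in> dependence p' \<and> a \<in> dependence q'"
    using assms(1,2) unfolding splits_def by (elim conjE commonly_separated_pair)
  have *: "f * dilate a (dilate b f) = dilate a f * dilate b f"
    if "f = u * v" "splits u v" "a \<in> dependence u \<and> b \<in> dependence v
      \<or> b \<in> dependence u \<and> a \<in> dependence v" for f u v
  proof -
    have "a \<notin> dependence v \<and> b \<notin> dependence u \<or> b \<notin> dependence v \<and> a \<notin> dependence u"
      using that by (auto simp: splits_def)
    then show ?thesis
      using dilate_commute[of a b u] dilate_commute[of a b v]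
      by (auto simp: that(1) notin_dependence)
  qed
  let ?f = "p * q"
  have "dilate i c = c" for i using c by (auto simp: dependence_def)
  then have "(?f + c) * (dilate a (dilate b ?f) + c) = (dilate a ?f + c) * (dilate b ?f + c)"
    using *[OF eq[symmetric] assms(2) ab'] unfolding eq by simp
  moreover have "?f * dilate a (dilate b ?f) = dilate a ?f * dilate b ?f"
    using *[OF refl assms(1)] ab by blast
  ultimately have "c * mixed_diff a b ?f = 0"
    unfolding mixed_diff_def by algebra
  moreover have "mixed_diff a b ?f \<noteq> 0"
    using mixed_diff_splits[OF assms(1) ab] .
  ultimately show ?thesis by simp
qed

lemma splits_not_single:
  assumes "splits p q"
  shows "dependence (p * q) \<noteq> {i}"
proof -
  obtain a b where "a \<in> dependence p" "b \<in> dependence q" "a \<noteq> b"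
    using assms unfolding splits_def by (metis disjoint_iff ex_in_conv)
  then show ?thesis unfolding dependence_splits[OF assms] by (metis UnI1 UnI2 singletonD)
qed

text \<open>Equal dependence puts both functions in the same case, since a variable depends on one
  index and a split product on at least two.\<close>

lemma product_type_constant_diff:
  assumes f: "product_type f" and g: "product_type g"
    and dep: "dependence f = dependence g" and c: "dependence (f - g) = {}"
  shows "f = g"
  using f
proof (cases rule: product_type_cases)
  case f: (var i)
  from g show ?thesis
  proof (cases rule: product_type_cases)
    case g: (var j)
    have "i = j" using f g dep by auto
    \<comment> \<open>Each possible difference is doubled by the dilation, yet a constant is fixed
      by it, which leaves \<open>0\<close>.\<close>
    then have "f - g = 0 \<or> f - g = 2 * var i \<or> f - g = - (2 * var i)"
      using f g by auto
    then have "dilate i (f - g) = 2 * (f - g)"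
      by (elim disjE) (simp_all only: dilate_0 dilate_uminus dilate_times dilate_numeral_2
          dilate_var simp_thms if_True mult_zero_right mult_minus_right)
    moreover have "dilate i (f - g) = f - g"
      using c by (auto simp: dependence_def simp del: dilate_diff)
    ultimately show ?thesis
      unfolding mult_2 by (metis add_cancel_left_right eq_iff_diff_eq_0)
  next
    case (splits p q)
    have "dependence f = {i}" using f by auto
    with splits_not_single[OF splits(1), of i] show ?thesis
      unfolding dep splits(2) by (rule notE)
  qed
next
  case f: (splits p' q')
  from g show ?thesis
  proof (cases rule: product_type_cases)
    case (var i)
    then have "dependence g = {i}" by auto
    with splits_not_single[OF f(1), of i] show ?thesis
      unfolding dep[symmetric] f(2) by (rule notE)
  next
    case g: (splits p q)
    have "f - g = 0"
    proof (rule splits_constant_diff_eq_0[OF g(1) f(1)])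
      show "dependence (p' * q') = dependence (p * q)" unfolding f(2)[symmetric] g(2)[symmetric] dep ..
      show "p' * q' = p * q + (f - g)" unfolding f(2)[symmetric] g(2)[symmetric] by simp
    qed (rule c)
    then show ?thesis by simp
  qed
qed

section \<open>Matching the summands of equal sums\<close>

lemma summand_contained:
  assumes A: "finite A" "disjoint_family_on (\<lambda>i. dependence (f i)) A"
    and B: "finite B" "disjoint_family_on (\<lambda>i. dependence (g i)) B"
    and eq: "sum f A = sum g B" and i: "i \<in> A" "product_type (f i)"
  shows "\<exists>j\<in>B. dependence (f i) \<subseteq> dependence (g j)"
proof (rule dependence_within_summand)
  show "dependence (f i) \<subseteq> (\<Union>j\<in>B. dependence (g j))"
    using dependence_sum[OF A] dependence_sum[OF B] eq i by auto
next
  fix a b assume ab: "a \<in> dependence (f i)" "b \<in> dependence (f i)"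
  \<comment> \<open>On variables of \<open>f i\<close> the other summands contribute nothing, so the
    whole sum has the mixed difference of \<open>f i\<close>.\<close>
  have "mixed_diff a b (f l) = 0" if "l \<in> A - {i}" for l
    using that i ab A(2) by (intro mixed_diff_eq_0) (auto simp: disjoint_family_on_def)
  then have "mixed_diff a b (sum f A) = mixed_diff a b (f i)"
    unfolding mixed_diff_sum using A i by (subst sum.remove[of A i]) auto
  then show "mixed_diff a b (f i) = mixed_diff a b (sum g B)" using eq by simp
qed (rule i B)+

text \<open>Containment in both directions makes the dependence sets of \<open>f i\<close> and some
  \<open>g j\<close> equal. Their difference is also a difference of the remaining summands, which
  avoid that set, so it is constant and hence zero.\<close>

lemma summand_matches:
  assumes A: "finite A" "disjoint_family_on (\<lambda>i. dependence (f i)) A" "\<And>i. i \<in> A \<Longrightarrow> product_type (f i)"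
    and B: "finite B" "disjoint_family_on (\<lambda>i. dependence (g i)) B" "\<And>i. i \<in> B \<Longrightarrow> product_type (g i)"
    and eq: "sum f A = sum g B" and i: "i \<in> A"
  shows "\<exists>j\<in>B. g j = f i"
proof -
  obtain j where j: "j \<in> B" "dependence (f i) \<subseteq> dependence (g j)"
    using summand_contained[OF A(1,2) B(1,2) eq i A(3)[OF i]] by auto
  obtain i' where i': "i' \<in> A" "dependence (g j) \<subseteq> dependence (f i')"
    using summand_contained[OF B(1,2) A(1,2) eq[symmetric] j(1) B(3)[OF j(1)]] by auto
  \<comment> \<open>The nonempty set \<open>dependence (f i)\<close> lies in
    \<open>dependence (f i')\<close>, so disjointness identifies the indices.\<close>
  have "i' = i"
    using A(2) i i' j product_type_dependence[OF A(3)[OF i]] unfolding disjoint_family_on_def by blast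
  then have dep: "dependence (f i) = dependence (g j)" using i' j by auto
  have "dependence (f i - g j) = {}"
  proof (rule ccontr)
    assume "\<not> ?thesis"
    then obtain a where a: "a \<in> dependence (f i - g j)" by auto
    have ai: "a \<in> dependence (f i)"
    proof (rule ccontr)
      assume "a \<notin> dependence (f i)"
      then have "dilate a (f i) = f i" "dilate a (g j) = g j"
        using notin_dependence dep by blast+
      with a show False by (simp add: dependence_def)
    qed
    have "dilate a (f l) = f l" if "l \<in> A - {i}" for l
      unfolding notin_dependence[symmetric] using A(2) that i ai
      by (auto simp: disjoint_family_on_def)
    moreover have "dilate a (g l) = g l" if "l \<in> B - {j}" for l
      unfolding notin_dependence[symmetric] using B(2) that j ai
      by (auto simp: dep disjoint_family_on_def)
    moreover have "f i - g j = sum g (B - {j}) - sum f (A - {i})"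
      using eq sum.remove[OF A(1) i, of f] sum.remove[OF B(1) j(1), of g] by (simp add: algebra_simps)
    ultimately have "dilate a (f i - g j) = f i - g j" by simp
    with a show False by (simp add: dependence_def)
  qed
  then show ?thesis
    using product_type_constant_diff[OF A(3)[OF i] B(3)[OF j(1)] dep] j(1) by metis
qed

text \<open>Equal values have the same nonempty dependence, which disjointness forbids at distinct
  indices. Matching values thus becomes a bijection of indices.\<close>

lemma product_type_inj_on:
  assumes "disjoint_family_on (\<lambda>i. dependence (f i)) A" "\<And>i. i \<in> A \<Longrightarrow> product_type (f i)"
  shows "inj_on f A"
proof (rule inj_onI)
  fix i j assume ij: "i \<in> A" "j \<in> A" "f i = f j"
  then have "dependence (f i) \<inter> dependence (f j) \<noteq> {}"
    using product_type_dependence[OF assms(2)[OF ij(1)]] by simp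
  then show "i = j" using assms(1) ij(1,2) unfolding disjoint_family_on_def by blast
qed

theorem theorem3p2:
  fixes s1 s2 :: nat and f1 f2 :: "nat \<Rightarrow> zratfun"
  assumes "s1 \<ge> 2" and "s2 \<ge> 2"
    and "\<And>i. i \<in> {1..s1} \<Longrightarrow> product_type (f1 i)"
    and "\<And>i. i \<in> {1..s2} \<Longrightarrow> product_type (f2 i)"
    and "disjoint_family_on (\<lambda>i. Var (f1 i)) {1..s1}"
    and "disjoint_family_on (\<lambda>i. Var (f2 i)) {1..s2}"
    and "\<exists>k>0. sum_expr k (\<Sum>i=1..s1. f1 i)"
    and "\<exists>k>0. sum_expr k (\<Sum>i=1..s2. f2 i)"
  shows "(\<Sum>i=1..s1. f1 i) = (\<Sum>i=1..s2. f2 i) \<longleftrightarrow>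
    s2 = s1 \<and> (\<exists>\<pi>. \<pi> permutes {1..s1} \<and> (\<forall>i\<in>{1..s1}. f2 (\<pi> i) = f1 i))"
proof
  assume eq: "(\<Sum>i=1..s1. f1 i) = (\<Sum>i=1..s2. f2 i)"
  note D1 = disjoint_family_dependence[OF assms(5)] and D2 = disjoint_family_dependence[OF assms(6)]
  have inj1: "inj_on f1 {1..s1}" and inj2: "inj_on f2 {1..s2}"
    using product_type_inj_on[OF D1] product_type_inj_on[OF D2] assms(3,4) by blast+
  have "\<exists>j\<in>{1..s2}. f2 j = f1 i" if "i \<in> {1..s1}" for i
    using summand_matches[OF _ D1 assms(3) _ D2 assms(4) eq that] by simp
  moreover have "\<exists>j\<in>{1..s1}. f1 j = f2 i" if "i \<in> {1..s2}" for i
    using summand_matches[OF _ D2 assms(4) _ D1 assms(3) eq[symmetric] that] by simp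
  ultimately have img: "f1 ` {1..s1} = f2 ` {1..s2}" by (auto simp: image_iff) metis+
  then have s: "s2 = s1" using card_image[OF inj1] card_image[OF inj2] by simp
  define h where "h = inv_into {1..s2} f2 \<circ> f1"
  have "bij_betw h {1..s1} {1..s2}"
    unfolding h_def using inj1 inj2 img
    by (intro bij_betw_trans[of f1 _ "f1 ` {1..s1}"] bij_betw_inv_into) (auto simp: bij_betw_def)
  then have bij: "bij_betw h {1..s1} {1..s1}" by (simp add: s)
  have h: "f2 (h i) = f1 i" if "i \<in> {1..s1}" for i
    using that img unfolding h_def comp_def by (intro f_inv_into_f) blast
  \<comment> \<open>\<open>permutes\<close> demands the identity outside \<open>{1..s1}\<close>,
    where \<open>h\<close> is arbitrary.\<close>
  let ?\<pi> = "\<lambda>i. if i \<in> {1..s1} then h i else i"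
  have "bij_betw ?\<pi> {1..s1} {1..s1}" using bij by (rule bij_betw_cong[THEN iffD1, rotated]) auto
  then have "?\<pi> permutes {1..s1}" by (rule bij_imp_permutes) auto
  then show "s2 = s1 \<and> (\<exists>\<pi>. \<pi> permutes {1..s1} \<and> (\<forall>i\<in>{1..s1}. f2 (\<pi> i) = f1 i))"
    using s h by (intro conjI exI[of _ ?\<pi>]) auto
next
  assume "s2 = s1 \<and> (\<exists>\<pi>. \<pi> permutes {1..s1} \<and> (\<forall>i\<in>{1..s1}. f2 (\<pi> i) = f1 i))"
  then obtain \<pi> where s: "s2 = s1" and \<pi>: "\<pi> permutes {1..s1}" "\<forall>i\<in>{1..s1}. f2 (\<pi> i) = f1 i"
    by blast
  have "(\<Sum>i=1..s2. f2 i) = (\<Sum>i=1..s1. f2 (\<pi> i))"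
    unfolding s using sum.permute[OF \<pi>(1), of f2] by (simp add: comp_def)
  also have "\<dots> = (\<Sum>i=1..s1. f1 i)" using \<pi>(2) by (intro sum.cong) auto
  finally show "(\<Sum>i=1..s1. f1 i) = (\<Sum>i=1..s2. f2 i)" by simp
qed

end
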